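(* Let $C = EFE^T$, where $E \in \mathbb{R}^{m\times p}$ and $F \in \mathbb{R}^{p\times p}$ is symmetric and nonsingular, $p = \operatorname{rank}(C)$, and let $G$ be chosen such that the matrix $\begin{bmatrix} G & 0 \\ 0 & F^{-1}\end{bmatrix}$ is symmetric and positive definite on $\mathrm{Null}(N)$, where $N = \begin{bmatrix} B & E \end{bmatrix}$. Let $q_0\in\mathbb{R}^m$ be arbitrary. Then the Projected Arnoldi Process with starting guesses $x_0\in\mathbb{R}^n$ and $w_0=-FE^Tq_0$, such that $Bx_0+Ew_0=0$, is equivalent to the Constraint-Preconditioned (CP) Arnoldi Process with starting guesses $x_0$ and $q_0$. In particular, for all $k$ (for which they are generated), the vectors $v_{k,x}$ and $v_{k,w}$ and the scalars $h_{i,k}$ in the Projected Arnoldi Process are equal, respectively, to the vectors $p_k$ and $FE^Tq_k$ and to the scalars $h_{i,k}$ in the CP-Arnoldi Process.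
   Context: Setting: $A \in \mathbb{R}^{n\times n}$ (possibly nonsymmetric), $B \in \mathbb{R}^{m\times n}$, $C \in \mathbb{R}^{m\times m}$ is nonzero and symmetric, $b \in \mathbb{R}^n$, and $K = \begin{bmatrix} A & B^T \\ B & -C\end{bmatrix}$ is nonsingular. The matrix $G \in \mathbb{R}^{n\times n}$ is such that $P = \begin{bmatrix} G & B^T \\ B & -C\end{bmatrix}$ is nonsingular. $[u\,;\,v]$ denotes the column vector obtained by stacking $u$ over $v$. Projected Arnoldi Process. Call "projection of $[u_x\,;\,u_w]$" the solution $[\bar u_x\,;\,\bar u_w\,;\,\bar z]$ of $$\begin{bmatrix} G & 0 & B^T \\ 0 & F^{-1} & E^T \\ B & E & 0\end{bmatrix}\begin{bmatrix}\bar u_x\\ \bar u_w\\ \bar z\end{bmatrix} = \begin{bmatrix} u_x\\ u_w\\ 0\end{bmatrix}.$$ Choose $[x_0\,;\,w_0]$ with $Bx_0+Ew_0=0$. Set $v_{0,x}=0$, $v_{0,w}=-w_0$, $u_{0,x}=b-Ax_0$, $u_{0,w}=-F^{-1}w_0$. Let $[\bar u_{1,x}\,;\,\bar u_{1,w}\,;\,\bar z_1]$ be the projection of $[u_{0,x}\,;\,u_{0,w}]$. Set $v_{1,x}=\bar u_{1,x}$, $v_{1,w}=\bar u_{1,w}$, $h_{1,0}=(v_{1,x}^Tu_{0,x}+v_{1,w}^Tu_{0,w})^{1/2}$; if $h_{1,0}\ne0$, divide $v_{1,x}$ and $v_{1,w}$ by $h_{1,0}$. For $k=1,2,\dots$,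 while $h_{k,k-1}\ne0$: set $u_{k,x}=Av_{k,x}$, $u_{k,w}=F^{-1}v_{k,w}$; let $[\bar u_{k+1,x}\,;\,\bar u_{k+1,w}\,;\,\bar z_{k+1}]$ be the projection of $[u_{k,x}\,;\,u_{k,w}]$; set $v_{k+1,x}=\bar u_{k+1,x}$, $v_{k+1,w}=\bar u_{k+1,w}$; for $i=1,\dots,k$, set $h_{i,k}=v_{i,x}^Tu_{k,x}+v_{i,w}^Tu_{k,w}$ and replace $v_{k+1,x}$ by $v_{k+1,x}-h_{i,k}v_{i,x}$ and $v_{k+1,w}$ by $v_{k+1,w}-h_{i,k}v_{i,w}$; then set $h_{k+1,k}=(v_{k+1,x}^Tu_{k,x}+v_{k+1,w}^Tu_{k,w})^{1/2}$; if $h_{k+1,k}\ne0$, divide $v_{k+1,x}$ and $v_{k+1,w}$ by $h_{k+1,k}$. CP-Arnoldi Process. Choose $[x_0\,;\,q_0]$ with $Bx_0-Cq_0=0$. Set $p_0=0$, $u_0=b-Ax_0$, $t_0=Cq_0$. Let $[\bar p_1\,;\,\bar z_1]$ solve $P[\bar p_1\,;\,\bar z_1]=[u_0\,;\,-t_0]$. Set $p_1=\bar p_1$, $q_1=q_0-\bar z_1$, $h_{1,0}=(p_1^Tu_0+q_1^Tt_0)^{1/2}$; if $h_{1,0}\ne0$, divide $p_1$ and $q_1$ by $h_{1,0}$. For $k=1,2,\dots$, while $h_{k,k-1}\ne0$: set $u_k=Ap_k$, $t_k=Cq_k$; let $[\bar p_{k+1}\,;\,\bar z_{k+1}]$ solve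 $P[\bar p_{k+1}\,;\,\bar z_{k+1}]=[u_k\,;\,-t_k]$; set $p_{k+1}=\bar p_{k+1}$, $q_{k+1}=q_k-\bar z_{k+1}$; for $i=1,\dots,k$, set $h_{i,k}=p_i^Tu_k+q_i^Tt_k$ and replace $p_{k+1}$ by $p_{k+1}-h_{i,k}p_i$ and $q_{k+1}$ by $q_{k+1}-h_{i,k}q_i$; then set $h_{k+1,k}=(p_{k+1}^Tu_k+q_{k+1}^Tt_k)^{1/2}$; if $h_{k+1,k}\ne0$, divide $p_{k+1}$ and $q_{k+1}$ by $h_{k+1,k}$. In both processes, $v_{k,x},v_{k,w},p_k,q_k$ denote, for $k\ge1$, the final (normalized) vectors. "Equivalent" means that the quantities generated by the two processes correspond to each other as listed in the claim. *)

theory Defs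
  imports "HOL-Analysis.Analysis"
begin

definition stack :: "'a^'n \<Rightarrow> 'a^'m \<Rightarrow> 'a^('n::finite + 'm::finite)" where
  "stack u v = (\<chi> i. case i of Inl a \<Rightarrow> u $ a | Inr c \<Rightarrow> v $ c)"

definition upper :: "'a^('n::finite + 'm::finite) \<Rightarrow> 'a^'n" where
  "upper y = (\<chi> i. y $ Inl i)"

definition lower :: "'a^('n::finite + 'm::finite) \<Rightarrow> 'a^'m" where
  "lower y = (\<chi> i. y $ Inr i)"

definition block_row :: "'a^'n^'m \<Rightarrow> 'a^'p^'m \<Rightarrow> 'a^('n::finite + 'p::finite)^'m" where
  "block_row X Y = (\<chi> i. stack (X $ i) (Y $ i))"

definition block_mat ::
  "'a^'n^'r \<Rightarrow> 'a^'m^'r \<Rightarrow> 'a^'n^'s \<Rightarrow> 'a^'m^'s \<Rightarrow> 'a^('n::finite + 'm::finite)^('r::finite + 's::finite)" where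
  "block_mat X Y Z W = stack (block_row X Y) (block_row Z W)"

definition symmetric_matrix :: "real^'n^'n \<Rightarrow> bool" where
  "symmetric_matrix M \<longleftrightarrow> transpose M = M"

definition null_space :: "real^'n^'m \<Rightarrow> (real^'n) set" where
  "null_space M = {y. M *v y = 0}"

definition positive_definite_on :: "(real^'n) set \<Rightarrow> real^'n^'n \<Rightarrow> bool" where
  "positive_definite_on S M \<longleftrightarrow> (\<forall>y\<in>S. y \<noteq> 0 \<longrightarrow> 0 < y \<bullet> (M *v y))"

text \<open>\<open>saddle_matrix G B C\<close> is the constraint preconditioner \<open>P\<close>;
  \<open>saddle_matrix A B C\<close> is the system matrix \<open>K\<close>.\<close>

definition saddle_matrix :: "real^'n^'n \<Rightarrow> real^'n^'m \<Rightarrow> real^'m^'m \<Rightarrow> real^('n::finite + 'm::finite)^('n::finite + 'm::finite)" where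
  "saddle_matrix H B C = block_mat H (transpose B) B (- C)"

definition the_solution :: "real^'n^'m \<Rightarrow> real^'m \<Rightarrow> real^'n" where
  "the_solution M r = (THE y. M *v y = r)"

text \<open>The matrix below is
  \<open>[G, 0, B^T; 0, F^{-1}, E^T; B, E, 0]\<close>, with its first two block rows and columns
  grouped together.  The result is the pair of the first two components of the solution;
  the third one is not used by the process.\<close>

definition projection ::
  "real^'n^'m \<Rightarrow> real^'p^'m \<Rightarrow> real^'p^'p \<Rightarrow> real^'n^'n \<Rightarrow> real^'n \<Rightarrow> real^'p
    \<Rightarrow> (real^'n) \<times> (real^'p)" where
  "projection B E F G ux uw =
    (let N = block_row B E;
         y = the_solution
               (block_mat (block_mat G 0 0 (matrix_inv F)) (transpose N) N 0)
               (stack (stack ux uw) 0)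
     in (upper (upper y), lower (upper y)))"

text \<open>State of an Arnoldi process.  \<open>idx\<close> is the index \<open>k\<close> of the most recently generated
  vector.  The entries \<open>vtop j\<close>, \<open>vbot j\<close> (\<open>j \<le> k\<close>) hold the two components of
  the generated vectors, i.e. the vectors with subscripts \<open>j,x\<close> and \<open>j,w\<close> of the
  Projected Arnoldi Process, or \<open>p\<close> and \<open>q\<close> with subscript \<open>j\<close> of the CP-Arnoldi
  Process.  The entries \<open>hess i j\<close> (\<open>j < k\<close>, \<open>1 \<le> i \<le> j + 1\<close>) hold the generated scalars.
  All other entries are meaningless.\<close>

record ('n::finite, 'l::finite) arnoldi_state =
  idx :: nat
  vtop :: "nat \<Rightarrow> real^'n"
  vbot :: "nat \<Rightarrow> real^'l"
  hess :: "nat \<Rightarrow> nat \<Rightarrow> real"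

definition initial_state :: "real^'l \<Rightarrow> ('n::finite, 'l::finite) arnoldi_state" where
  "initial_state w = \<lparr>idx = 0, vtop = (\<lambda>_. 0), vbot = (\<lambda>_. 0)(0 := w), hess = (\<lambda>_ _. 0)\<rparr>"

text \<open>The remaining operations are common to both processes: \<open>u\<close> and \<open>t\<close> are the two
  components of the vector (with subscript \<open>k\<close>) to which the projection or the
  preconditioner has been applied.\<close>

definition set_vector ::
  "nat \<Rightarrow> real^'n \<Rightarrow> real^'l \<Rightarrow> ('n, 'l) arnoldi_state \<Rightarrow> ('n::finite, 'l::finite) arnoldi_state" where
  "set_vector j x w s = s\<lparr>vtop := (vtop s)(j := x), vbot := (vbot s)(j := w)\<rparr>"

definition set_coeff ::
  "nat \<Rightarrow> nat \<Rightarrow> real \<Rightarrow> ('n, 'l) arnoldi_state \<Rightarrow> ('n::finite, 'l::finite) arnoldi_state" where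
  "set_coeff i j c s = s\<lparr>hess := (hess s)(i := (hess s i)(j := c))\<rparr>"

definition orthogonalize_against ::
  "nat \<Rightarrow> real^'n \<Rightarrow> real^'l \<Rightarrow> nat \<Rightarrow> ('n, 'l) arnoldi_state \<Rightarrow> ('n::finite, 'l::finite) arnoldi_state" where
  "orthogonalize_against k u t i s =
    (let c = vtop s i \<bullet> u + vbot s i \<bullet> t
     in set_vector (k + 1) (vtop s (k + 1) - c *\<^sub>R vtop s i) (vbot s (k + 1) - c *\<^sub>R vbot s i)
          (set_coeff i k c s))"

definition normalize_new ::
  "nat \<Rightarrow> real^'n \<Rightarrow> real^'l \<Rightarrow> ('n, 'l) arnoldi_state \<Rightarrow> ('n::finite, 'l::finite) arnoldi_state" where
  "normalize_new k u t s =
    (let c = sqrt (vtop s (k + 1) \<bullet> u + vbot s (k + 1) \<bullet> t);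
         s' = set_coeff (k + 1) k c s
     in if c \<noteq> 0
        then set_vector (k + 1) (vtop s (k + 1) /\<^sub>R c) (vbot s (k + 1) /\<^sub>R c) s'
        else s')"

text \<open>\<open>x\<close> and \<open>w\<close> are the values of the new vector before orthogonalization.  For \<open>k = 0\<close>
  the orthogonalization loop is empty.\<close>

definition append_vector ::
  "real^'n \<Rightarrow> real^'l \<Rightarrow> real^'n \<Rightarrow> real^'l \<Rightarrow> ('n, 'l) arnoldi_state \<Rightarrow> ('n::finite, 'l::finite) arnoldi_state" where
  "append_vector u t x w s =
    (let k = idx s;
         s1 = set_vector (k + 1) x w s;
         s2 = fold (orthogonalize_against k u t) [1..<k + 1] s1;
         s3 = normalize_new k u t s2
     in s3\<lparr>idx := k + 1\<rparr>)"

definition terminated :: "('n::finite, 'l::finite) arnoldi_state \<Rightarrow> bool" where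
  "terminated s \<longleftrightarrow> idx s \<ge> 1 \<and> hess s (idx s) (idx s - 1) = 0"

definition projected_arnoldi_step ::
  "real^'n^'n \<Rightarrow> real^'n^'m \<Rightarrow> real^'p^'m \<Rightarrow> real^'p^'p \<Rightarrow> real^'n^'n \<Rightarrow> real^'n
    \<Rightarrow> real^'n \<Rightarrow> real^'p \<Rightarrow> ('n, 'p) arnoldi_state \<Rightarrow> ('n, 'p) arnoldi_state" where
  "projected_arnoldi_step A B E F G b x0 w0 s =
    (if terminated s then s
     else
       let k = idx s;
           ux = (if k = 0 then b - A *v x0 else A *v vtop s k);
           uw = (if k = 0 then - (matrix_inv F *v w0) else matrix_inv F *v vbot s k);
           (x, w) = projection B E F G ux uw
       in append_vector ux uw x w s)"

text \<open>The state reached after at most \<open>k\<close> passes, the first of which is the one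
  that generates \<open>h\<^sub>1\<^sub>,\<^sub>0\<close>; a terminated process does not change any more.\<close>

definition projected_arnoldi ::
  "real^'n^'n \<Rightarrow> real^'n^'m \<Rightarrow> real^'p^'m \<Rightarrow> real^'p^'p \<Rightarrow> real^'n^'n \<Rightarrow> real^'n
    \<Rightarrow> real^'n \<Rightarrow> real^'p \<Rightarrow> nat \<Rightarrow> ('n, 'p) arnoldi_state" where
  "projected_arnoldi A B E F G b x0 w0 k =
    (projected_arnoldi_step A B E F G b x0 w0 ^^ k) (initial_state (- w0))"

definition cp_arnoldi_step ::
  "real^'n^'n \<Rightarrow> real^'n^'m \<Rightarrow> real^'m^'m \<Rightarrow> real^'n^'n \<Rightarrow> real^'n
    \<Rightarrow> real^'n \<Rightarrow> real^'m \<Rightarrow> ('n, 'm) arnoldi_state \<Rightarrow> ('n, 'm) arnoldi_state" where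
  "cp_arnoldi_step A B C G b x0 q0 s =
    (if terminated s then s
     else
       let k = idx s;
           u = (if k = 0 then b - A *v x0 else A *v vtop s k);
           t = (if k = 0 then C *v q0 else C *v vbot s k);
           y = the_solution (saddle_matrix G B C) (stack u (- t))
       in append_vector u t (upper y) (vbot s k - lower y) s)"

definition cp_arnoldi ::
  "real^'n^'n \<Rightarrow> real^'n^'m \<Rightarrow> real^'m^'m \<Rightarrow> real^'n^'n \<Rightarrow> real^'n
    \<Rightarrow> real^'n \<Rightarrow> real^'m \<Rightarrow> nat \<Rightarrow> ('n, 'm) arnoldi_state" where
  "cp_arnoldi A B C G b x0 q0 k = (cp_arnoldi_step A B C G b x0 q0 ^^ k) (initial_state q0)"

end

theory Submission
  imports Defs
begin

text \<open>Put \<open>M = F E\<^sup>T\<close>.  The substitution \<open>w = M q\<close> carries the CP-Arnoldi process to the projected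
  one.  If \<open>[p; z]\<close> solves the system with matrix \<open>P\<close> and right-hand side \<open>[u; -C q]\<close>, then
  \<open>[p; M (q - z); z]\<close> solves the projection system with right-hand side \<open>[u; E\<^sup>T q; 0]\<close>, and
  \<open>E\<^sup>T q = F\<^sup>-\<^sup>1 (M q)\<close>.  Moreover \<open>(M r) \<bullet> (E\<^sup>T q) = r \<bullet> (C q)\<close>, so all scalars computed by the two
  processes agree.\<close>

section \<open>Block vectors and block matrices\<close>

lemma upper_stack [simp]: "upper (stack u v) = u"
  and lower_stack [simp]: "lower (stack u v) = v"
  by (simp_all add: upper_def lower_def stack_def vec_eq_iff)

lemma stack_upper_lower [simp]: "stack (upper y) (lower y) = y"
  by (auto simp: upper_def lower_def stack_def vec_eq_iff split: sum.split)

lemma stack_eq_iff [simp]: "stack u v = stack u' v' \<longleftrightarrow> u = u' \<and> v = v'"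
  by (metis upper_stack lower_stack)

lemma stack_eq_0_iff [simp]: "stack u v = 0 \<longleftrightarrow> u = 0 \<and> v = 0"
proof -
  have "stack 0 0 = (0 :: 'a^('b + 'c))"
    by (auto simp: stack_def vec_eq_iff split: sum.split)
  then show ?thesis
    by (metis stack_eq_iff)
qed

lemma stack_add: "stack u v + stack u' v' = stack (u + u') (v + v')"
  by (auto simp: stack_def vec_eq_iff split: sum.split)

lemma block_row_mult_stack [simp]:
  fixes X :: "real^'n^'m" and Y :: "real^'p^'m"
  shows "block_row X Y *v stack u v = X *v u + Y *v v"
  \<comment> \<open>The sum over the index type \<open>'n + 'p\<close> splits once its
    \<open>UNIV\<close> is written as a disjoint union, so \<open>UNIV_Plus_UNIV\<close> is applied
    from right to left.\<close>
  by (simp add: vec_eq_iff matrix_vector_mult_def block_row_def stack_def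
      sum.Plus UNIV_Plus_UNIV [symmetric] del: UNIV_Plus_UNIV)

lemma stack_matrix_mult:
  fixes R :: "real^'n^'r" and S :: "real^'n^'s"
  shows "stack R S *v y = stack (R *v y) (S *v y)"
  by (auto simp: vec_eq_iff matrix_vector_mult_def stack_def split: sum.split)

lemma block_mat_mult_stack [simp]:
  fixes X :: "real^'n^'r" and Y :: "real^'m^'r" and Z :: "real^'n^'s" and W :: "real^'m^'s"
  shows "block_mat X Y Z W *v stack u v = stack (X *v u + Y *v v) (Z *v u + W *v v)"
  by (simp add: block_mat_def stack_matrix_mult)

lemma transpose_block_row:
  fixes X :: "real^'n^'m" and Y :: "real^'p^'m"
  shows "transpose (block_row X Y) = stack (transpose X) (transpose Y)"
  by (auto simp: vec_eq_iff transpose_def block_row_def stack_def split: sum.split)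

text \<open>As a simp rule this turns \<open>transpose E *v x\<close> into \<open>x v* E\<close>,
  which would hide the products with \<open>transpose B\<close> and \<open>transpose E\<close> from
  the associativity rules.\<close>

declare transpose_matrix_vector [simp del]

lemma minus_matrix_vector_mult: "(- M) *v x = - (M *v x)" for M :: "real^'n^'m"
  by (simp add: vec_eq_iff matrix_vector_mult_def sum_negf)

lemma saddle_matrix_mult_stack [simp]:
  "saddle_matrix H B C *v stack x z = stack (H *v x + transpose B *v z) (B *v x - C *v z)"
  by (simp add: saddle_matrix_def minus_matrix_vector_mult)

section \<open>Inverses and uniquely solvable systems\<close>

lemma matrix_inv_mult_cancel:
  fixes F :: "real^'n^'n"
  assumes "invertible F"
  shows "F *v (matrix_inv F *v x) = x" and "matrix_inv F *v (F *v x) = x"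
proof -
  have "F ** matrix_inv F = mat 1 \<and> matrix_inv F ** F = mat 1"
    using assms unfolding invertible_def matrix_inv_def by (rule someI_ex)
  then show "F *v (matrix_inv F *v x) = x" and "matrix_inv F *v (F *v x) = x"
    by (simp_all add: matrix_vector_mul_assoc)
qed

lemma invertible_iff_ker:
  fixes M :: "real^'n^'n"
  shows "invertible M \<longleftrightarrow> (\<forall>y. M *v y = 0 \<longrightarrow> y = 0)"
  by (simp add: invertible_left_inverse matrix_left_invertible_ker)

lemma the_solution_eqI:
  fixes M :: "real^'n^'n"
  assumes "invertible M" and "M *v y = r"
  shows "the_solution M r = y"
  unfolding the_solution_def
proof (rule the_equality)
  show "y' = y" if "M *v y' = r" for y'
    using that assms by (metis matrix_inv_mult_cancel(2))
qed (fact assms)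

lemma the_solution_correct:
  fixes M :: "real^'n^'n"
  assumes "invertible M"
  shows "M *v the_solution M r = r"
  using the_solution_eqI [OF assms] matrix_inv_mult_cancel(1) [OF assms] by metis

section \<open>The projection system and the preconditioner\<close>

lemma projection_matrix_mult_stack:
  fixes G :: "real^'n^'n" and B :: "real^'n^'m" and E :: "real^'p^'m" and F :: "real^'p^'p"
  shows "block_mat (block_mat G 0 0 (matrix_inv F)) (transpose (block_row B E)) (block_row B E) 0
      *v stack (stack x w) z =
    stack (stack (G *v x + transpose B *v z) (matrix_inv F *v w + transpose E *v z))
      (B *v x + E *v w)"
  by (simp add: transpose_block_row stack_matrix_mult stack_add)

text \<open>Block elimination: for a kernel vector the second block row expresses \<open>w\<close>
  through \<open>z\<close>. Substituting it into the last row leaves the homogeneous system of the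
  saddle matrix, so \<open>x\<close> and \<open>z\<close> vanish, and then \<open>w\<close> does
  too.\<close>

lemma invertible_projection_matrix:
  assumes P: "invertible (saddle_matrix G B (E ** F ** transpose E))" and F: "invertible F"
  shows "invertible (block_mat (block_mat G 0 0 (matrix_inv F))
    (transpose (block_row B E)) (block_row B E) 0)" (is "invertible ?K")
  unfolding invertible_iff_ker
proof (intro allI impI)
  fix y
  assume "?K *v y = 0"
  moreover obtain x w z where y: "y = stack (stack x w) z"
    by (metis stack_upper_lower)
  ultimately have x: "G *v x + transpose B *v z = 0"
    and w: "matrix_inv F *v w + transpose E *v z = 0" and z: "B *v x + E *v w = 0"
    by (simp_all add: projection_matrix_mult_stack del: block_mat_mult_stack)
  have "w = F *v (- (transpose E *v z))"
    using w by (metis F add_eq_0_iff2 matrix_inv_mult_cancel(1))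
  then have w': "w = - (F *v (transpose E *v z))"
    by (simp add: vec.neg)
  then have "B *v x - (E ** F ** transpose E) *v z = 0"
    using z by (simp add: vec.neg matrix_vector_mul_assoc matrix_mul_assoc)
  then have "saddle_matrix G B (E ** F ** transpose E) *v stack x z = 0"
    using x by simp
  then have "x = 0 \<and> z = 0"
    using P by (metis invertible_iff_ker stack_eq_0_iff)
  then show "y = 0"
    using y w' by simp
qed

text \<open>The same elimination read backwards: a solution with the saddle matrix extends to one of
  the projection system, and uniqueness identifies it with the projection. The difference
  \<open>q - lower y\<close> is exactly the new lower vector of the CP process.\<close>

lemma projection_eq_preconditioner:
  assumes P: "invertible (saddle_matrix G B (E ** F ** transpose E))" and F: "invertible F"
    and y: "y = the_solution (saddle_matrix G B (E ** F ** transpose E))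
      (stack u (- ((E ** F ** transpose E) *v q)))"
  shows "projection B E F G u (transpose E *v q) = (upper y, (F ** transpose E) *v (q - lower y))"
proof -
  let ?w = "(F ** transpose E) *v (q - lower y)"
  have "saddle_matrix G B (E ** F ** transpose E) *v stack (upper y) (lower y)
      = stack u (- ((E ** F ** transpose E) *v q))"
    using the_solution_correct [OF P] y by simp
  then have u: "G *v upper y + transpose B *v lower y = u"
    and q: "B *v upper y - (E ** F ** transpose E) *v lower y = - ((E ** F ** transpose E) *v q)"
    by (simp_all del: stack_upper_lower)
  have "matrix_inv F *v ?w + transpose E *v lower y = transpose E *v q"
    using matrix_inv_mult_cancel(2) [OF F]
    by (simp flip: matrix_vector_mul_assoc add: vec.diff)
  \<comment> \<open>As \<open>E\<close> times \<open>F ** transpose E\<close> is the lower right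
    block up to sign, this is \<open>q\<close> with both of its terms in that block collected on one
    side.\<close>
  moreover have "B *v upper y + E *v ?w = 0"
    using q by (simp add: matrix_vector_mul_assoc matrix_mul_assoc vec.diff algebra_simps)
  ultimately have "the_solution (block_mat (block_mat G 0 0 (matrix_inv F))
      (transpose (block_row B E)) (block_row B E) 0) (stack (stack u (transpose E *v q)) 0)
      = stack (stack (upper y) ?w) (lower y)"
    using u by (intro the_solution_eqI invertible_projection_matrix P F)
      (simp add: projection_matrix_mult_stack del: block_mat_mult_stack)
  then show ?thesis
    by (simp add: projection_def)
qed

section \<open>Transport of states along a linear map\<close>

text \<open>Transforming all entries of \<open>vbot\<close>, meaningless ones included, lets the
  correspondence be stated as one equation between whole states.\<close>

definition map_bot ::
  "real^'m^'p \<Rightarrow> ('n, 'm) arnoldi_state \<Rightarrow> ('n::finite, 'p::finite) arnoldi_state" where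
  "map_bot M s =
    \<lparr>idx = idx s, vtop = vtop s, vbot = (\<lambda>j. M *v vbot s j), hess = hess s\<rparr>"

lemma map_bot_simps [simp]:
  "idx (map_bot M s) = idx s" "vtop (map_bot M s) = vtop s"
  "vbot (map_bot M s) = (\<lambda>j. M *v vbot s j)" "hess (map_bot M s) = hess s"
  by (simp_all add: map_bot_def)

lemma map_bot_idx_update: "map_bot M s\<lparr>idx := k\<rparr> = map_bot M (s\<lparr>idx := k\<rparr>)"
  by (simp add: map_bot_def)

lemma map_bot_initial_state: "map_bot M (initial_state q) = initial_state (M *v q)"
  by (auto simp: map_bot_def initial_state_def)

lemma map_bot_set_vector: "set_vector j x (M *v q) (map_bot M s) = map_bot M (set_vector j x q s)"
  by (auto simp: map_bot_def set_vector_def)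

lemma map_bot_set_coeff: "set_coeff i j c (map_bot M s) = map_bot M (set_coeff i j c s)"
  by (simp add: map_bot_def set_coeff_def)

lemma map_bot_terminated: "terminated (map_bot M s) = terminated s"
  by (simp add: terminated_def)

text \<open>The vector \<open>t'\<close> enters only through inner products, so the adjointness
  hypothesis makes the coefficients agree; linearity of \<open>M\<close> then carries it through the
  update.\<close>

lemma map_bot_orthogonalize_against:
  assumes "\<And>q. (M *v q) \<bullet> t' = q \<bullet> t"
  shows "orthogonalize_against k u t' i (map_bot M s) = map_bot M (orthogonalize_against k u t i s)"
  by (simp add: orthogonalize_against_def Let_def assms map_bot_set_coeff
      flip: map_bot_set_vector vec.diff matrix_vector_mult_scaleR)

lemma map_bot_normalize_new:
  assumes "\<And>q. (M *v q) \<bullet> t' = q \<bullet> t"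
  shows "normalize_new k u t' (map_bot M s) = map_bot M (normalize_new k u t s)"
  by (simp add: normalize_new_def Let_def assms map_bot_set_coeff
      flip: map_bot_set_vector matrix_vector_mult_scaleR)

lemma map_bot_append_vector:
  assumes "\<And>q. (M *v q) \<bullet> t' = q \<bullet> t"
  shows "append_vector u t' x (M *v q) (map_bot M s) = map_bot M (append_vector u t x q s)"
proof -
  \<comment> \<open>The state \<open>r\<close> is arbitrary because each pass of the loop changes
    it.\<close>
  have "fold (orthogonalize_against k u t') is (map_bot M r)
      = map_bot M (fold (orthogonalize_against k u t) is r)" for k "is" r
    by (induction "is" arbitrary: r) (simp_all add: map_bot_orthogonalize_against [OF assms])
  then show ?thesis
    by (simp add: append_vector_def Let_def map_bot_set_vector map_bot_idx_update
        map_bot_normalize_new [OF assms])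
qed

section \<open>Correspondence of the two processes\<close>

lemma projected_arnoldi_step_map_bot:
  assumes P: "invertible (saddle_matrix G B (E ** F ** transpose E))" and F: "invertible F"
    and sym: "symmetric_matrix F"
    and w0: "w0 = - ((F ** transpose E) *v q0)"
    and start: "idx s = 0 \<Longrightarrow> vbot s 0 = q0"
  shows "projected_arnoldi_step A B E F G b x0 w0 (map_bot (F ** transpose E) s) =
    map_bot (F ** transpose E) (cp_arnoldi_step A B (E ** F ** transpose E) G b x0 q0 s)"
proof (cases "terminated s")
  case True
  then show ?thesis
    by (simp add: projected_arnoldi_step_def cp_arnoldi_step_def map_bot_terminated)
next
  case False
  define M where "M = F ** transpose E"
  define C where "C = E ** F ** transpose E"
  define q where "q = vbot s (idx s)"
  define u where "u = (if idx s = 0 then b - A *v x0 else A *v vtop s (idx s))"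
  define y where "y = the_solution (saddle_matrix G B C) (stack u (- (C *v q)))"
  \<comment> \<open>Symmetry of \<open>F\<close> enters here: it makes \<open>E ** F\<close> the
    adjoint of \<open>M\<close>.\<close>
  have inner: "(M *v r) \<bullet> (transpose E *v q) = r \<bullet> (C *v q)" for r
  proof -
    have "transpose M = E ** F"
      using sym by (simp add: M_def matrix_transpose_mul symmetric_matrix_def)
    then have "M *v r = r v* (E ** F)"
      by (metis vector_transpose_matrix)
    then show ?thesis
      by (simp add: dot_lmul_matrix C_def matrix_vector_mul_assoc)
  qed
  have inv: "matrix_inv F *v (M *v q) = transpose E *v q"
    by (simp add: M_def matrix_inv_mult_cancel(2) [OF F] flip: matrix_vector_mul_assoc)
  \<comment> \<open>The sign in the first pass cancels the one in \<open>w0\<close>, so all passes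
    share one formula.\<close>
  have uw: "(if idx s = 0 then - (matrix_inv F *v w0) else matrix_inv F *v (M *v vbot s (idx s)))
      = transpose E *v q"
    using inv start by (auto simp: w0 q_def M_def vec.neg)
  have t: "(if idx s = 0 then C *v q0 else C *v vbot s (idx s)) = C *v q"
    using start by (auto simp: q_def)
  have "projected_arnoldi_step A B E F G b x0 w0 (map_bot M s)
      = (case projection B E F G u (transpose E *v q) of (x, w) \<Rightarrow>
          append_vector u (transpose E *v q) x w (map_bot M s))"
    using False by (simp only: projected_arnoldi_step_def map_bot_terminated map_bot_simps Let_def
        uw u_def [symmetric] if_False)
  also have "\<dots> = append_vector u (transpose E *v q) (upper y) (M *v (q - lower y)) (map_bot M s)"
    using projection_eq_preconditioner [OF P F y_def [unfolded C_def]] by (simp add: M_def)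
  also have "\<dots> = map_bot M (append_vector u (C *v q) (upper y) (q - lower y) s)"
    by (rule map_bot_append_vector [OF inner])
  also have "append_vector u (C *v q) (upper y) (q - lower y) s
      = cp_arnoldi_step A B C G b x0 q0 s"
    using False t by (simp add: cp_arnoldi_step_def Let_def u_def y_def q_def)
  finally show ?thesis
    by (simp add: M_def C_def)
qed

lemma idx_append_vector: "idx (append_vector u t x w s) = idx s + 1"
  by (simp add: append_vector_def Let_def)

text \<open>A terminated state has positive index by definition, and any other state is advanced.
  Index 0 thus occurs only before the first pass, when \<open>vbot\<close> still holds
  \<open>q0\<close>; this provides the premise \<open>start\<close> in the induction.\<close>

lemma idx_cp_arnoldi_step_pos:
  "idx (cp_arnoldi_step A B C G b x0 q0 s) \<noteq> 0"
  by (auto simp: cp_arnoldi_step_def Let_def idx_append_vector terminated_def)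

lemma cp_arnoldi_vbot_0:
  "idx (cp_arnoldi A B C G b x0 q0 k) = 0 \<Longrightarrow> vbot (cp_arnoldi A B C G b x0 q0 k) 0 = q0"
  by (cases k) (simp_all add: cp_arnoldi_def initial_state_def idx_cp_arnoldi_step_pos)

lemma projected_arnoldi_eq_map_bot:
  assumes "invertible (saddle_matrix G B (E ** F ** transpose E))" and "invertible F"
    and "symmetric_matrix F" and w0: "w0 = - ((F ** transpose E) *v q0)"
  shows "projected_arnoldi A B E F G b x0 w0 k =
    map_bot (F ** transpose E) (cp_arnoldi A B (E ** F ** transpose E) G b x0 q0 k)"
proof (induction k)
  case 0
  then show ?case
    by (simp add: projected_arnoldi_def cp_arnoldi_def map_bot_initial_state w0)
next
  case (Suc k)
  then show ?case
    using projected_arnoldi_step_map_bot [OF assms cp_arnoldi_vbot_0]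
    by (simp add: projected_arnoldi_def cp_arnoldi_def)
qed

theorem theorem5p1:
  fixes A G :: "real^'n^'n" and B :: "real^'n^'m" and C :: "real^'m^'m"
    and E :: "real^'p^'m" and F :: "real^'p^'p"
    and b x0 :: "real^'n" and q0 :: "real^'m" and w0 :: "real^'p"
  assumes "C \<noteq> 0" and "symmetric_matrix C"
    and "invertible (saddle_matrix A B C)"
    and "invertible (saddle_matrix G B C)"
    and "C = E ** F ** transpose E"
    and "symmetric_matrix F" and "invertible F"
    and "CARD('p) = rank C"
    and "symmetric_matrix (block_mat G 0 0 (matrix_inv F))"
    and "positive_definite_on (null_space (block_row B E)) (block_mat G 0 0 (matrix_inv F))"
    and "w0 = - ((F ** transpose E) *v q0)"
    and "B *v x0 + E *v w0 = 0"
  shows "B *v x0 - C *v q0 = 0 \<and>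
    (\<forall>k. let PA = projected_arnoldi A B E F G b x0 w0 k;
             CP = cp_arnoldi A B C G b x0 q0 k
         in idx PA = idx CP \<and>
            (\<forall>j \<le> idx PA. vtop PA j = vtop CP j \<and>
                           vbot PA j = (F ** transpose E) *v vbot CP j) \<and>
            (\<forall>j < idx PA. \<forall>i \<in> {1..j + 1}. hess PA i j = hess CP i j))"
proof (intro conjI allI)
  have "C *v q0 = E *v ((F ** transpose E) *v q0)"
    using \<open>C = _\<close> by (simp add: matrix_vector_mul_assoc matrix_mul_assoc)
  then show "B *v x0 - C *v q0 = 0"
    using \<open>w0 = _\<close> \<open>B *v x0 + E *v w0 = 0\<close> by (simp add: vec.neg)
next
  fix k
  \<comment> \<open>This equality of states contains all three claims, which
    \<open>map_bot_simps\<close> reads off componentwise.\<close>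
  have "projected_arnoldi A B E F G b x0 w0 k =
      map_bot (F ** transpose E) (cp_arnoldi A B C G b x0 q0 k)"
    using projected_arnoldi_eq_map_bot assms by metis
  then show "let PA = projected_arnoldi A B E F G b x0 w0 k;
             CP = cp_arnoldi A B C G b x0 q0 k
         in idx PA = idx CP \<and>
            (\<forall>j \<le> idx PA. vtop PA j = vtop CP j \<and>
                           vbot PA j = (F ** transpose E) *v vbot CP j) \<and>
            (\<forall>j < idx PA. \<forall>i \<in> {1..j + 1}. hess PA i j = hess CP i j)"
    by simp
qed

end
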